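(* Let $L$ be a discrete semimodular lattice and let $A \subseteq L$. Then $A$ is an antichain cutset of $L$ if and only if $A$ is a level class of $L$.
   Context: An antichain cutset in a partially ordered set is a set of elements that intersects every maximal chain in exactly one element (a singleton). A poset is discrete if every interval $[x,y]$ has a finite maximal chain. A lattice is semimodular if it satisfies the covering condition: whenever $x$ covers $x\wedge y$, then $x\vee y$ covers $y$. In any poset, define the symmetric relation $x\sim y$ iff there exists an element $z$ covered by both $x$ and $y$; let $\equiv$ be the reflexive-transitive closure of $\sim$. A level class (level) is an equivalence class of $\equiv$. *)

theory Defs
  imports Main
begin

definition maximal_chain :: "'a::order set \<Rightarrow> 'a set \<Rightarrow> bool"
  where "maximal_chain S C \<longleftrightarrow> pred_on.maxchain S (<) C"

definition antichain_cutset :: "'a::order set \<Rightarrow> bool"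
  where "antichain_cutset A \<longleftrightarrow> (\<forall>C. maximal_chain UNIV C \<longrightarrow> (\<exists>a. A \<inter> C = {a}))"

definition covers :: "'a::order \<Rightarrow> 'a \<Rightarrow> bool"
  where "covers x y \<longleftrightarrow> y < x \<and> (\<nexists>z. y < z \<and> z < x)"

definition discrete_poset :: "'a::order itself \<Rightarrow> bool"
  where "discrete_poset _ \<longleftrightarrow>
    (\<forall>x y :: 'a. x \<le> y \<longrightarrow> (\<exists>C. finite C \<and> maximal_chain {x..y} C))"

definition semimodular :: "'a::lattice itself \<Rightarrow> bool"
  where "semimodular _ \<longleftrightarrow>
    (\<forall>x y :: 'a. covers x (inf x y) \<longrightarrow> covers (sup x y) y)"

definition level_adj :: "'a::order \<Rightarrow> 'a \<Rightarrow> bool"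
  where "level_adj x y \<longleftrightarrow> (\<exists>z. covers x z \<and> covers y z)"

definition level_rel :: "('a::order \<times> 'a) set"
  where "level_rel = {(x, y). level_adj\<^sup>*\<^sup>* x y}"

lemma equiv_level_rel: "equiv UNIV level_rel"
proof (rule equivI)
  have "symp (level_adj\<^sup>*\<^sup>* :: 'a \<Rightarrow> 'a \<Rightarrow> bool)"
    by (rule symp_rtranclp) (auto simp: symp_def level_adj_def)
  then show "sym (level_rel :: ('a \<times> 'a) set)"
    by (auto simp: sym_def symp_def level_rel_def)
qed (auto simp: level_rel_def refl_on_def trans_def)

definition level_class :: "'a::order set \<Rightarrow> bool"
  where "level_class A \<longleftrightarrow> A \<in> UNIV // level_rel"

end

theory Submission
  imports Defs
begin

text \<open>
  Semimodularity yields the Jordan--Dedekind condition: all saturated chains between two elements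
  have the same length. Fixing an element \<open>a\<close>, measuring lengths from common lower bounds gives an
  integer-valued rank that increases by one along covers and vanishes exactly on the level of \<open>a\<close>.
  A maximal chain takes consecutive rank values, and it cannot stop before reaching rank zero
  because its least or greatest element would be the bottom or top of the lattice; so it meets the
  level exactly once.

  Conversely, let \<open>A\<close> be an antichain cutset with \<open>x \<in> A\<close>, and let \<open>x\<close> and \<open>y\<close> cover \<open>z\<close>.
  A maximal chain through \<open>z < y < x \<squnion> y\<close> can only meet \<open>A\<close> in \<open>y\<close>, all its other elements being
  comparable to \<open>x\<close>. Hence \<open>A\<close> contains a whole level, which is itself a cutset, and so \<open>A\<close> equals it.
\<close>

subsection \<open>Maximal chains\<close>

text \<open>Maximality under inclusion becomes an elementwise test: an element comparable with the
  whole chain could be inserted, so it must already belong.\<close>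

lemma maximal_chain_iff:
  fixes S :: "'a::order set"
  shows "maximal_chain S C \<longleftrightarrow> C \<subseteq> S \<and> (\<forall>x\<in>C. \<forall>y\<in>C. x \<le> y \<or> y \<le> x) \<and>
    (\<forall>x\<in>S. (\<forall>c\<in>C. x \<le> c \<or> c \<le> x) \<longrightarrow> x \<in> C)" (is "?L \<longleftrightarrow> ?R")
proof
  have chain: "pred_on.chain S (<) D \<longleftrightarrow> D \<subseteq> S \<and> (\<forall>x\<in>D. \<forall>y\<in>D. x \<le> y \<or> y \<le> x)" for D
    unfolding pred_on.chain_def by (auto simp: le_less)
  {
    assume L: ?L
    then have "pred_on.chain S (<) C" and max: "\<not> (\<exists>D. pred_on.chain S (<) D \<and> C \<subset> D)"
      unfolding maximal_chain_def pred_on.maxchain_def by blast+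
    then have C: "C \<subseteq> S" "\<forall>x\<in>C. \<forall>y\<in>C. x \<le> y \<or> y \<le> x"
      unfolding chain by blast+
    have "x \<in> C" if "x \<in> S" "\<forall>c\<in>C. x \<le> c \<or> c \<le> x" for x
    proof -
      have "pred_on.chain S (<) (insert x C)"
        unfolding chain using C that by auto
      then show ?thesis using max by blast
    qed
    with C show ?R by blast
  next
    assume R: ?R
    show ?L
      unfolding maximal_chain_def pred_on.maxchain_def chain
    proof (intro conjI notI)
      assume "\<exists>D. (D \<subseteq> S \<and> (\<forall>x\<in>D. \<forall>y\<in>D. x \<le> y \<or> y \<le> x)) \<and> C \<subset> D"
      then obtain D where D: "D \<subseteq> S" "\<forall>x\<in>D. \<forall>y\<in>D. x \<le> y \<or> y \<le> x" "C \<subset> D" by blast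
      then obtain x where "x \<in> D" "x \<notin> C" by blast
      with D R show False by blast
    qed (use R in blast)+
  }
qed

lemma maximal_chainD:
  assumes "maximal_chain UNIV C"
  shows "x \<in> C \<Longrightarrow> y \<in> C \<Longrightarrow> x \<le> y \<or> y \<le> x"
    and "(\<And>c. c \<in> C \<Longrightarrow> x \<le> c \<or> c \<le> x) \<Longrightarrow> x \<in> C"
  using assms unfolding maximal_chain_iff by blast+

text \<open>The Hausdorff principle is applied inside the set of elements comparable with all of
  \<open>K\<close>. A maximal chain there absorbs \<open>K\<close> and stays maximal in the whole
  order.\<close>

lemma maximal_chain_extends:
  fixes K :: "'a::order set"
  assumes "\<And>x y. x \<in> K \<Longrightarrow> y \<in> K \<Longrightarrow> x \<le> y \<or> y \<le> x"
  obtains C where "maximal_chain UNIV C" "K \<subseteq> C"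
proof -
  define S where "S = {x. \<forall>k\<in>K. x \<le> k \<or> k \<le> x}"
  obtain C where "maximal_chain S C"
    using pred_on.Hausdorff unfolding maximal_chain_def by blast
  then have C: "C \<subseteq> S" "\<forall>x\<in>C. \<forall>y\<in>C. x \<le> y \<or> y \<le> x"
    "\<And>x. x \<in> S \<Longrightarrow> (\<forall>c\<in>C. x \<le> c \<or> c \<le> x) \<Longrightarrow> x \<in> C"
    unfolding maximal_chain_iff by blast+
  have "K \<subseteq> C"
  proof
    fix k assume "k \<in> K"
    then show "k \<in> C" using C(1) assms by (intro C(3)) (auto simp: S_def)
  qed
  moreover have "maximal_chain UNIV C"
    unfolding maximal_chain_iff
  proof (intro conjI ballI impI)
    fix x assume "\<forall>c\<in>C. x \<le> c \<or> c \<le> x"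
    then show "x \<in> C" using \<open>K \<subseteq> C\<close> by (intro C(3)) (auto simp: S_def)
  qed (use C(2) in auto)
  ultimately show thesis using that by blast
qed

text \<open>Comparable elements lie on a common maximal chain, which meets \<open>A\<close> only
  once.\<close>

lemma antichain_cutset_comparable_eq:
  assumes "antichain_cutset A" "x \<in> A" "y \<in> A" "x \<le> y \<or> y \<le> x"
  shows "x = y"
proof -
  obtain C where C: "maximal_chain UNIV C" "{x, y} \<subseteq> C"
    using maximal_chain_extends[of "{x, y}"] assms(4) by blast
  then obtain a where a: "A \<inter> C = {a}"
    using assms(1) unfolding antichain_cutset_def by blast
  have "x \<in> A \<inter> C" "y \<in> A \<inter> C" using C assms(2,3) by auto
  then show ?thesis unfolding a by simp
qed

subsection \<open>Saturated chains\<close>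

text \<open>\<open>covers\<close> takes the upper element first, hence the swap; \<open>n\<close>
  counts steps, not elements.\<close>

abbreviation saturated :: "nat \<Rightarrow> 'a::order \<Rightarrow> 'a \<Rightarrow> bool"
  where "saturated n x y \<equiv> ((\<lambda>u v. covers v u) ^^ n) x y"

lemma saturated_le: "saturated n x y \<Longrightarrow> x \<le> y"
  by (induction n arbitrary: y) (fastforce simp: covers_def)+

lemma saturated_trans: "saturated m x y \<Longrightarrow> saturated n y z \<Longrightarrow> saturated (m + n) x z"
  by (auto simp: relpowp_add)

lemma saturated_SucI: "covers w x \<Longrightarrow> saturated n w y \<Longrightarrow> saturated (Suc n) x y"
  by (rule relpowp_Suc_I2)

lemma saturated_SucE:
  assumes "saturated (Suc n) x y"
  obtains w where "covers w x" "saturated n w y"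
  using assms by (metis relpowp_Suc_E2)

text \<open>Neighbours in a finite maximal chain of the interval form a covering pair, since
  anything strictly between them would be comparable with the whole chain. Induction descends from
  neighbour to neighbour.\<close>

lemma discrete_ex_saturated:
  fixes x y :: "'a::order"
  assumes "discrete_poset TYPE('a)" "x \<le> y"
  shows "\<exists>n. saturated n x y"
proof -
  obtain C where "finite C" "maximal_chain {x..y} C"
    using assms unfolding discrete_poset_def by blast
  then have C: "finite C" "C \<subseteq> {x..y}" "\<forall>u\<in>C. \<forall>v\<in>C. u \<le> v \<or> v \<le> u"
    and max: "\<And>u. u \<in> {x..y} \<Longrightarrow> \<forall>c\<in>C. u \<le> c \<or> c \<le> u \<Longrightarrow> u \<in> C"
    unfolding maximal_chain_iff by blast+
  have bounds: "x \<le> c" "c \<le> y" if "c \<in> C" for c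
    using C(2) that by auto
  have xC: "x \<in> C" and yC: "y \<in> C"
    using bounds assms(2) by (auto intro!: max)
  have "\<exists>n. saturated n x c" if "c \<in> C" for c
    using that
  proof (induction "card {d \<in> C. d < c}" arbitrary: c rule: less_induct)
    case less
    show ?case
    proof (cases "c = x")
      case True
      then show ?thesis by (intro exI[of _ 0]) simp
    next
      case False
      let ?D = "{d \<in> C. d < c}"
      have "x \<in> ?D" using xC False less.prems bounds by (auto simp: order_less_le)
      then obtain d where d: "d \<in> ?D" and dmax: "\<And>e. e \<in> ?D \<Longrightarrow> d \<le> e \<Longrightarrow> e = d"
        using finite_has_maximal[of ?D] C(1) by force
      have cov: "covers c d"
        unfolding covers_def
      proof (intro conjI notI)
        show "d < c" using d by blast
        assume "\<exists>z. d < z \<and> z < c"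
        then obtain z where z: "d < z" "z < c" by blast
        have "z \<le> e \<or> e \<le> z" if e: "e \<in> C" for e
        proof (cases "c \<le> e")
          case True
          then show ?thesis using z by (meson less_imp_le order_trans)
        next
          case False
          then have "e \<in> ?D" using e C(3) less.prems by (auto simp: less_le_not_le)
          then have "e \<le> d" using dmax C(3) d e by blast
          then show ?thesis using z by (meson less_imp_le order_trans)
        qed
        moreover have "z \<in> {x..y}"
          using bounds(1)[of d] bounds(2)[of c] z d less.prems
          by (auto dest!: less_imp_le intro: order_trans)
        ultimately have "z \<in> C" using max by blast
        then show False using dmax[of z] z by (auto simp: less_imp_le)
      qed
      have "card {e \<in> C. e < d} < card ?D"
      proof (rule psubset_card_mono)
        show "{e \<in> C. e < d} \<subset> ?D" using d by auto
      qed (use C(1) in simp)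
      then obtain n where "saturated n x d" using less.hyps d by blast
      then have "saturated (Suc n) x c" using cov by auto
      then show ?thesis by blast
    qed
  qed
  then show ?thesis using yC by blast
qed

section \<open>Semimodularity and the Jordan--Dedekind condition\<close>

lemma covers_eq_if_le:
  assumes "covers x z" "covers y z" "x \<le> y"
  shows "x = y"
  using assms unfolding covers_def by (auto simp: le_less)

text \<open>Distinct covers of \<open>z\<close> are incomparable, so \<open>z\<close> is their meet
  and the covering condition applies to either of them.\<close>

lemma semimodular_covers_sup:
  fixes x y z :: "'a::lattice"
  assumes sm: "semimodular TYPE('a)" and x: "covers x z" and y: "covers y z" and "x \<noteq> y"
  shows "covers (sup x y) x" "covers (sup x y) y"
proof -
  have "z \<le> inf x y" using x y by (auto simp: covers_def)
  moreover have "inf x y < x"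
    using covers_eq_if_le[OF x y] \<open>x \<noteq> y\<close> by (metis inf.cobounded2 inf_le1 le_less)
  ultimately have "inf x y = z" using x unfolding covers_def by (metis le_less)
  then show "covers (sup x y) y" "covers (sup x y) x"
    using sm x y unfolding semimodular_def by (metis, metis inf.commute sup.commute)
qed

text \<open>The first step of a chain can be exchanged for \<open>w\<close>: if the chain starts
  with \<open>v \<noteq> w\<close>, then \<open>sup v w\<close> covers both and lies below
  \<open>y\<close>, so induction at \<open>v\<close> yields a chain from \<open>sup v w\<close>,
  which is prolonged down to \<open>w\<close>.\<close>

lemma saturated_above_atom:
  fixes x y w :: "'a::lattice"
  assumes "semimodular TYPE('a)" "saturated (Suc n) x y" "covers w x" "w \<le> y"
  shows "saturated n w y"
  using assms(2-)
proof (induction n arbitrary: x w)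
  case 0
  then obtain v where "covers v x" "v = y" by (auto elim: saturated_SucE)
  with 0 show ?case using covers_eq_if_le by fastforce
next
  case (Suc n)
  obtain v where v: "covers v x" "saturated (Suc n) v y"
    using Suc.prems(1) by (rule saturated_SucE)
  show ?case
  proof (cases "v = w")
    case True
    then show ?thesis using v by simp
  next
    case False
    have cov: "covers (sup v w) v" "covers (sup v w) w"
      using semimodular_covers_sup[OF assms(1) v(1) Suc.prems(2) False] by auto
    have "sup v w \<le> y" using saturated_le[OF v(2)] Suc.prems(3) by simp
    then have "saturated n (sup v w) y" by (rule Suc.IH[OF v(2) cov(1)])
    then show ?thesis using cov(2) by (rule saturated_SucI[rotated])
  qed
qed

lemma saturated_unique:
  fixes x y :: "'a::lattice"
  assumes "semimodular TYPE('a)" "saturated m x y" "saturated n x y"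
  shows "m = n"
  using assms(2-)
proof (induction m arbitrary: x n)
  case 0
  show ?case
  proof (cases n)
    case (Suc k)
    then obtain w where "covers w x" "saturated k w y" using 0 saturated_SucE by metis
    then show ?thesis using 0 saturated_le by (fastforce simp: covers_def)
  qed simp
next
  case (Suc m)
  obtain w where w: "covers w x" "saturated m w y"
    using Suc.prems(1) by (rule saturated_SucE)
  show ?case
  proof (cases n)
    case 0
    then show ?thesis using Suc.prems w saturated_le by (fastforce simp: covers_def)
  next
    case (Suc k)
    then have "saturated k w y"
      using saturated_above_atom[OF assms(1) _ w(1)] Suc.prems saturated_le[OF w(2)] by blast
    then show ?thesis using Suc.IH w Suc by blast
  qed
qed

lemma saturated_split:
  assumes "saturated n x y" "k \<le> n"
  obtains u where "saturated k x u" "saturated (n - k) u y"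
proof -
  have "saturated (k + (n - k)) x y" using assms by simp
  then show thesis using that unfolding relpowp_add by blast
qed

text \<open>Given first steps \<open>v\<close>, \<open>w\<close> towards \<open>x\<close>, \<open>y\<close>, the induction passes through an element above
  \<open>v \<squnion> w\<close> of the same height, comparing it to \<open>x\<close> over \<open>v\<close> and to \<open>y\<close> over \<open>w\<close>.\<close>

lemma level_if_saturated:
  fixes x y z :: "'a::lattice"
  assumes "discrete_poset TYPE('a)" "semimodular TYPE('a)" "saturated n z x" "saturated n z y"
  shows "level_adj\<^sup>*\<^sup>* x y"
  using assms(3-)
proof (induction n arbitrary: x y z)
  case 0
  then show ?case by simp
next
  case (Suc n)
  obtain v where v: "covers v z" "saturated n v x"
    using Suc.prems(1) by (rule saturated_SucE)
  obtain w where w: "covers w z" "saturated n w y"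
    using Suc.prems(2) by (rule saturated_SucE)
  show ?case
  proof (cases n)
    case 0
    then show ?thesis using v w unfolding level_adj_def by auto
  next
    case (Suc m)
    show ?thesis
    proof (cases "v = w")
      case True
      then show ?thesis using Suc.IH v w by blast
    next
      case False
      have cov: "covers (sup v w) v" "covers (sup v w) w"
        using semimodular_covers_sup[OF assms(2) v(1) w(1) False] by auto
      have "v \<le> x" "w \<le> y" using v w saturated_le by blast+
      then have "sup v w \<le> sup x y" by (rule sup_mono)
      then obtain k where k: "saturated k (sup v w) (sup x y)"
        using discrete_ex_saturated[OF assms(1)] by blast
      obtain l where l: "saturated l x (sup x y)"
        using discrete_ex_saturated[OF assms(1)] sup_ge1 by blast
      \<comment> \<open>Two saturated chains lead from \<open>v\<close> to \<open>sup x y\<close>,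
        one through \<open>sup v w\<close> and one through \<open>x\<close>.\<close>
      have "Suc k = n + l"
        using saturated_unique[OF assms(2) saturated_SucI[OF cov(1) k] saturated_trans[OF v(2) l]] .
      then have "m \<le> k" using Suc by simp
      then obtain u where u: "saturated m (sup v w) u" using k saturated_split by metis
      have "level_adj\<^sup>*\<^sup>* x u"
        using Suc.IH[OF v(2)] saturated_SucI[OF cov(1) u] Suc by simp
      moreover have "level_adj\<^sup>*\<^sup>* u y"
        using Suc.IH[OF _ w(2)] saturated_SucI[OF cov(2) u] Suc by simp
      ultimately show ?thesis by simp
    qed
  qed
qed

subsection \<open>Rank relative to a base element\<close>

definition height :: "'a::order \<Rightarrow> 'a \<Rightarrow> nat"
  where "height x y = (THE n. saturated n x y)"

text \<open>The meet is a canonical common lower bound; values are integers because \<open>x\<close>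
  may lie below the level of \<open>a\<close>.\<close>

definition rank :: "'a::lattice \<Rightarrow> 'a \<Rightarrow> int"
  where "rank a x = int (height (inf a x) x) - int (height (inf a x) a)"

lemma height_eqI:
  fixes x y :: "'a::lattice"
  assumes "semimodular TYPE('a)" "saturated n x y"
  shows "height x y = n"
  unfolding height_def using assms saturated_unique by blast

lemma saturated_height:
  fixes x y :: "'a::lattice"
  assumes "discrete_poset TYPE('a)" "semimodular TYPE('a)" "x \<le> y"
  shows "saturated (height x y) x y"
  using discrete_ex_saturated[OF assms(1,3)] height_eqI[OF assms(2)] by metis

lemma height_add:
  fixes x y z :: "'a::lattice"
  assumes "discrete_poset TYPE('a)" "semimodular TYPE('a)" "x \<le> y" "y \<le> z"
  shows "height x z = height x y + height y z"
  using height_eqI[OF assms(2) saturated_trans] saturated_height[OF assms(1,2)] assms(3,4) by blast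

text \<open>The height from \<open>w\<close> to \<open>inf a x\<close> enters both terms and
  cancels.\<close>

lemma rank_lower_bound:
  fixes a w x :: "'a::lattice"
  assumes "discrete_poset TYPE('a)" "semimodular TYPE('a)" "w \<le> a" "w \<le> x"
  shows "rank a x = int (height w x) - int (height w a)"
  using height_add[OF assms(1,2), of w "inf a x" x] height_add[OF assms(1,2), of w "inf a x" a] assms(3,4)
  unfolding rank_def by simp

lemma rank_diff:
  fixes a x y :: "'a::lattice"
  assumes "discrete_poset TYPE('a)" "semimodular TYPE('a)" "x \<le> y"
  shows "rank a y = rank a x + int (height x y)"
proof -
  have "inf a x \<le> a" "inf a x \<le> x" by simp_all
  moreover from this assms(3) have "inf a x \<le> y" by (metis order_trans)
  ultimately show ?thesis
    using assms by (simp add: rank_lower_bound[of "inf a x"] height_add[of "inf a x" x y])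
qed

lemma rank_self:
  fixes a :: "'a::lattice"
  shows "rank a a = 0"
  by (simp add: rank_def)

lemma rank_covers:
  fixes a x y :: "'a::lattice"
  assumes "discrete_poset TYPE('a)" "semimodular TYPE('a)" "covers y x"
  shows "rank a y = rank a x + 1"
proof -
  have "saturated 1 x y" using assms(3) by (simp only: relpowp_1)
  then have "height x y = 1" by (rule height_eqI[OF assms(2)])
  moreover have "x \<le> y" using assms(3) by (simp add: covers_def less_imp_le)
  ultimately show ?thesis using rank_diff[OF assms(1,2)] by simp
qed

lemma rank_eq_imp_eq:
  fixes a x y :: "'a::lattice"
  assumes "discrete_poset TYPE('a)" "semimodular TYPE('a)" "x \<le> y" "rank a x = rank a y"
  shows "x = y"
proof -
  have "height x y = 0" using rank_diff[OF assms(1-3), of a] assms(4) by simp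
  then show ?thesis using saturated_height[OF assms(1-3)] by simp
qed

text \<open>Adjacent elements have rank one above a common lower cover. Conversely, rank zero puts
  \<open>a\<close> and \<open>x\<close> at equal height over their meet.\<close>

lemma level_iff_rank:
  fixes a x :: "'a::lattice"
  assumes "discrete_poset TYPE('a)" "semimodular TYPE('a)"
  shows "level_adj\<^sup>*\<^sup>* a x \<longleftrightarrow> rank a x = 0"
proof
  assume "level_adj\<^sup>*\<^sup>* a x"
  then show "rank a x = 0"
  proof (induction rule: rtranclp_induct)
    case base
    show ?case by (rule rank_self)
  next
    case (step y z)
    then obtain w where "covers y w" "covers z w" unfolding level_adj_def by blast
    then show ?case using step.IH rank_covers[OF assms] by metis
  qed
next
  assume "rank a x = 0"
  then have "height (inf a x) a = height (inf a x) x" by (simp add: rank_def)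
  then show "level_adj\<^sup>*\<^sup>* a x"
    using level_if_saturated[OF assms] saturated_height[OF assms] by (metis inf_le1 inf_le2)
qed

subsection \<open>Maximal chains and levels\<close>

lemma maximal_chain_rank_pred:
  fixes a c :: "'a::lattice"
  assumes dp: "discrete_poset TYPE('a)" and sm: "semimodular TYPE('a)"
    and C: "maximal_chain UNIV C" "c \<in> C" and pos: "rank a c > 0"
  shows "\<exists>d\<in>C. rank a d = rank a c - 1"
proof -
  have "\<exists>d\<in>C. d < c"
  proof (rule ccontr)
    assume "\<not> ?thesis"
    then have le: "c \<le> d" if "d \<in> C" for d
      using that C(2) maximal_chainD(1)[OF C(1)] by (metis le_less)
    \<comment> \<open>A least element \<open>c\<close> of \<open>C\<close> makes
      \<open>inf c a\<close> comparable with all of \<open>C\<close>.\<close>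
    have "inf c a \<in> C"
      by (rule maximal_chainD(2)[OF C(1)]) (meson le inf_le1 order_trans)
    with le have "c \<le> a" by (metis le_inf_iff)
    then show False using rank_diff[OF dp sm, of c a a] pos by (simp add: rank_self)
  qed
  then obtain d0 where d0: "d0 \<in> C" "d0 < c" by blast
  define P where "P = (\<lambda>d. d \<in> C \<and> d < c)"
  \<comment> \<open>\<open>C\<close> may be infinite, so the predecessor of \<open>c\<close> is
    found by minimising a natural number, the distance to \<open>c\<close>.\<close>
  define d where "d = arg_min (\<lambda>d. height d c) P"
  have d: "d \<in> C" "d < c" and dmin: "\<And>e. e \<in> C \<Longrightarrow> e < c \<Longrightarrow> height d c \<le> height e c"
    using arg_min_nat_lemma[of P d0 "\<lambda>d. height d c"] d0 unfolding d_def P_def by auto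
  have between: "e \<le> d \<or> c \<le> e" if e: "e \<in> C" for e
  proof (rule ccontr)
    assume n: "\<not> ?thesis"
    then have "d < e" "e < c"
      using maximal_chainD(1)[OF C(1)] e d C(2) by (metis le_less)+
    then have "rank a d = rank a e"
      using dmin[OF e] rank_diff[OF dp sm, of d c a] rank_diff[OF dp sm, of e c a]
        rank_diff[OF dp sm, of d e a] by (simp add: order_less_imp_le d(2))
    then show False using rank_eq_imp_eq[OF dp sm, of d e a] \<open>d < e\<close> by (simp add: less_imp_le)
  qed
  have "covers c d"
    unfolding covers_def
  proof (intro conjI notI)
    assume "\<exists>z. d < z \<and> z < c"
    then obtain z where z: "d < z" "z < c" by blast
    have "z \<in> C"
      by (rule maximal_chainD(2)[OF C(1)]) (meson between z order_trans order_less_imp_le)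
    then show False using between z by (meson leD)
  qed (fact d(2))
  then show ?thesis using rank_covers[OF dp sm] d(1) by force
qed

text \<open>Semimodularity is not self-dual, but the argument for predecessors uses it only through
  the rank and therefore dualises.\<close>

lemma maximal_chain_rank_succ:
  fixes a c :: "'a::lattice"
  assumes dp: "discrete_poset TYPE('a)" and sm: "semimodular TYPE('a)"
    and C: "maximal_chain UNIV C" "c \<in> C" and neg: "rank a c < 0"
  shows "\<exists>d\<in>C. rank a d = rank a c + 1"
proof -
  have "\<exists>d\<in>C. c < d"
  proof (rule ccontr)
    assume "\<not> ?thesis"
    then have le: "d \<le> c" if "d \<in> C" for d
      using that C(2) maximal_chainD(1)[OF C(1)] by (metis le_less)
    have "sup c a \<in> C"
      by (rule maximal_chainD(2)[OF C(1)]) (meson le sup_ge1 order_trans)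
    with le have "a \<le> c" by (metis le_sup_iff)
    then show False using rank_diff[OF dp sm, of a c a] neg by (simp add: rank_self)
  qed
  then obtain d0 where d0: "d0 \<in> C" "c < d0" by blast
  define P where "P = (\<lambda>d. d \<in> C \<and> c < d)"
  define d where "d = arg_min (\<lambda>d. height c d) P"
  have d: "d \<in> C" "c < d" and dmin: "\<And>e. e \<in> C \<Longrightarrow> c < e \<Longrightarrow> height c d \<le> height c e"
    using arg_min_nat_lemma[of P d0 "\<lambda>d. height c d"] d0 unfolding d_def P_def by auto
  have between: "e \<le> c \<or> d \<le> e" if e: "e \<in> C" for e
  proof (rule ccontr)
    assume n: "\<not> ?thesis"
    then have "c < e" "e < d"
      using maximal_chainD(1)[OF C(1)] e d C(2) by (metis le_less)+
    then have "rank a e = rank a d"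
      using dmin[OF e] rank_diff[OF dp sm, of c d a] rank_diff[OF dp sm, of c e a]
        rank_diff[OF dp sm, of e d a] by (simp add: order_less_imp_le d(2))
    then show False using rank_eq_imp_eq[OF dp sm, of e d a] \<open>e < d\<close> by (simp add: less_imp_le)
  qed
  have "covers d c"
    unfolding covers_def
  proof (intro conjI notI)
    assume "\<exists>z. c < z \<and> z < d"
    then obtain z where z: "c < z" "z < d" by blast
    have "z \<in> C"
      by (rule maximal_chainD(2)[OF C(1)]) (meson between z order_trans order_less_imp_le)
    then show False using between z by (meson leD)
  qed (fact d(2))
  then show ?thesis using rank_covers[OF dp sm] d(1) by force
qed

lemma maximal_chain_rank_zero:
  fixes a :: "'a::lattice"
  assumes dp: "discrete_poset TYPE('a)" and sm: "semimodular TYPE('a)"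
    and C: "maximal_chain UNIV C"
  shows "\<exists>d\<in>C. rank a d = 0"
proof -
  \<comment> \<open>Were \<open>C\<close> empty, every element would vacuously be comparable with it
    and hence belong to it.\<close>
  obtain c where "c \<in> C" using maximal_chainD(2)[OF C] by blast
  then show ?thesis
  proof (induction "nat \<bar>rank a c\<bar>" arbitrary: c rule: less_induct)
    case less
    consider "rank a c = 0" | "rank a c > 0" | "rank a c < 0" by linarith
    then show ?case
    proof cases
      case 1
      then show ?thesis using less.prems by blast
    next
      case 2
      then obtain d where "d \<in> C" "rank a d = rank a c - 1"
        using maximal_chain_rank_pred[OF dp sm C less.prems] by blast
      with 2 show ?thesis by (intro less.hyps[of d]) auto
    next
      case 3
      then obtain d where "d \<in> C" "rank a d = rank a c + 1"
        using maximal_chain_rank_succ[OF dp sm C less.prems] by blast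
      with 3 show ?thesis by (intro less.hyps[of d]) auto
    qed
  qed
qed

lemma antichain_cutset_level:
  fixes a :: "'a::lattice"
  assumes "discrete_poset TYPE('a)" "semimodular TYPE('a)"
  shows "antichain_cutset {x. level_adj\<^sup>*\<^sup>* a x}"
  unfolding antichain_cutset_def
proof (intro allI impI)
  fix C :: "'a set" assume C: "maximal_chain UNIV C"
  obtain d where d: "d \<in> C" "rank a d = 0"
    using maximal_chain_rank_zero[OF assms C] by blast
  have "x = d" if "x \<in> C" "rank a x = 0" for x
    using maximal_chainD(1)[OF C that(1) d(1)] rank_eq_imp_eq[OF assms] that(2) d(2) by metis
  with d have "{x. level_adj\<^sup>*\<^sup>* a x} \<inter> C = {d}"
    unfolding level_iff_rank[OF assms] by blast
  then show "\<exists>b. {x. level_adj\<^sup>*\<^sup>* a x} \<inter> C = {b}" ..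
qed

section \<open>From antichain cutsets to levels\<close>

lemma antichain_cutset_level_adj:
  fixes x y :: "'a::lattice"
  assumes sm: "semimodular TYPE('a)" and A: "antichain_cutset A" and "x \<in> A" and adj: "level_adj x y"
  shows "y \<in> A"
proof (cases "x = y")
  case True
  then show ?thesis using \<open>x \<in> A\<close> by simp
next
  case False
  obtain z where z: "covers x z" "covers y z" using adj unfolding level_adj_def by blast
  have cov: "covers (sup x y) y"
    using semimodular_covers_sup(2)[OF sm z False] .
  have lt: "z < x" "z < y" "y < sup x y"
    using z cov by (auto simp: covers_def)
  obtain C where C: "maximal_chain UNIV C" "{z, y, sup x y} \<subseteq> C"
    using maximal_chain_extends[of "{z, y, sup x y}"] lt by (force simp: less_imp_le)
  obtain b where b: "b \<in> A" "b \<in> C"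
    using A C(1) unfolding antichain_cutset_def by blast
  \<comment> \<open>The chain contains \<open>y\<close>, which is incomparable with
    \<open>x\<close>, so \<open>b\<close> cannot be \<open>x\<close>.\<close>
  have "\<not> (b \<le> x \<or> x \<le> b)"
  proof
    assume "b \<le> x \<or> x \<le> b"
    then have "b = x" using antichain_cutset_comparable_eq[OF A b(1) \<open>x \<in> A\<close>] by blast
    then have "x \<le> y \<or> y \<le> x" using maximal_chainD(1)[OF C(1)] b C(2) by blast
    then show False using covers_eq_if_le z False by metis
  qed
  \<comment> \<open>Either relation would make \<open>b\<close> comparable with \<open>x\<close>.
    The two covering relations then leave only \<open>y\<close> for \<open>b\<close>.\<close>
  then have "\<not> b \<le> z" "\<not> sup x y \<le> b" using lt(1) by (auto dest: order_trans)
  then have "z < b" "b < sup x y" "b \<le> y \<or> y \<le> b"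
    using maximal_chainD(1)[OF C(1)] b C(2)
    unfolding less_le_not_le by blast+
  then have "b = y" using z(2) cov unfolding covers_def by (metis le_less)
  then show ?thesis using b by simp
qed

theorem mainTheorem1:
  fixes A :: "'a::lattice set"
  assumes "discrete_poset TYPE('a)"
    and "semimodular TYPE('a)"
  shows "antichain_cutset A \<longleftrightarrow> level_class A"
proof
  have level: "level_rel `` {a} = {x. level_adj\<^sup>*\<^sup>* a x}" for a :: 'a
    by (auto simp: level_rel_def)
  {
    assume "level_class A"
    then obtain a where "A = {x. level_adj\<^sup>*\<^sup>* a x}"
      unfolding level_class_def by (auto elim!: quotientE simp: level)
    then show "antichain_cutset A"
      using antichain_cutset_level[OF assms] by simp
  next
    assume A: "antichain_cutset A"
    obtain C :: "'a set" where "maximal_chain UNIV C"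
      using maximal_chain_extends[of "{}"] by blast
    then obtain a where a: "a \<in> A" using A unfolding antichain_cutset_def by blast
    have sub: "x \<in> A" if "level_adj\<^sup>*\<^sup>* a x" for x
      using that by induction (use a antichain_cutset_level_adj[OF assms(2) A] in auto)
    have "level_adj\<^sup>*\<^sup>* a b" if b: "b \<in> A" for b
    proof -
      \<comment> \<open>The level of \<open>a\<close> is a cutset inside \<open>A\<close>, so it
        meets a chain through \<open>b\<close> in an element of \<open>A\<close> comparable with
        \<open>b\<close>.\<close>
      obtain D where D: "maximal_chain UNIV D" "{b} \<subseteq> D"
        using maximal_chain_extends[of "{b}"] by blast
      then obtain x where x: "level_adj\<^sup>*\<^sup>* a x" "x \<in> D"
        using antichain_cutset_level[OF assms] unfolding antichain_cutset_def by blast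
      then have "x = b"
        using antichain_cutset_comparable_eq[OF A sub b] maximal_chainD(1)[OF D(1)] D(2) by blast
      with x show ?thesis by simp
    qed
    with sub have "A = level_rel `` {a}" unfolding level by blast
    then show "level_class A" unfolding level_class_def by (simp add: quotientI)
  }
qed

end
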